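(* Let $n$ and $p$ be positive integers. Let $O_1$ and $O_2$ be finite sequences of distinct objects ("vertices"), let $k$ be a single vertex, and let $P$ be a sequence of $p$ vertices, such that all vertices in $O_1$, $k$, $O_2$, $P$ are pairwise distinct and their total number is at most $n$. Define two arrangements: the arrangement "at index $i$" is the concatenation $O_1, P, k, O_2$, and the arrangement "at index $i+1$" is the concatenation $O_1, k, P, O_2$. For a vertex $w$, let $\pi_i[w]$ (resp. $\pi_{i+1}[w]$) be the position of $w$ (counted from $0$) in the arrangement at index $i$ (resp. $i+1$). For integers $a,b$ let $d_C(a,b)=\min\{|a-b|,\ n-|a-b|\}$, and for vertices $x,y$ set $CBS^{(i)}(x,y)=d_C(\pi_i[x],\pi_i[y])$ and $CBS^{(i+1)}(x,y)=d_C(\pi_{i+1}[x],\pi_{i+1}[y])$. Let $u$ be a vertex of $P$, $v$ a vertex of $O_2$, and $\Delta=\pi_i[v]-\pi_i[u]$. Then: 1. if $\Delta \le \frac{n}{2}$, then $CBS^{(i+1)}(u,v)=CBS^{(i)}(u,v)-1$; 2. if $\Delta \ge \frac{n}{2}+1$, then $CBS^{(i+1)}(u,v)=CBS^{(i)}(u,v)+1$; 3. if $\frac{n}{2}<\Delta<\frac{n}{2}+1$, then $CBS^{(i+1)}(u,v)=CBS^{(i)}(u,v)$.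
   Context: This arises when a path $P$ of $p$ vertices is inserted into a partial labeling (a list of vertices of a graph with $n$ vertices, the label of a vertex being its position in the list) either just before the vertex $k$ (index $i$) or just after it (index $i+1$); $d_C$ is the cyclic distance between labels on a cycle with $n$ positions. *)

theory Defs
  imports Complex_Main
begin

(* Meaningful only for w occurring exactly once in L. *)
definition position :: "'a list \<Rightarrow> 'a \<Rightarrow> nat" where
  "position L w = (THE j. j < length L \<and> L ! j = w)"

definition cyclic_dist :: "nat \<Rightarrow> int \<Rightarrow> int \<Rightarrow> int" where
  "cyclic_dist n a b = min \<bar>a - b\<bar> (int n - \<bar>a - b\<bar>)"

(* The arrangement at index i: the path P is inserted just before the vertex k. *)
definition arr_before :: "'a list \<Rightarrow> 'a \<Rightarrow> 'a list \<Rightarrow> 'a list \<Rightarrow> 'a list" where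
  "arr_before O1 k O2 P = O1 @ P @ [k] @ O2"

(* The arrangement at index i + 1: the path P is inserted just after the vertex k. *)
definition arr_after :: "'a list \<Rightarrow> 'a \<Rightarrow> 'a list \<Rightarrow> 'a list \<Rightarrow> 'a list" where
  "arr_after O1 k O2 P = O1 @ [k] @ P @ O2"

definition CBS :: "nat \<Rightarrow> 'a list \<Rightarrow> 'a \<Rightarrow> 'a \<Rightarrow> int" where
  "CBS n L x y = cyclic_dist n (int (position L x)) (int (position L y))"

end

theory Submission
  imports Defs
begin

text \<open>
  Moving P past k raises the position of u by one and fixes that of v, so the forward distance
  from u to v drops from \<Delta> to \<Delta> - 1. The three cases say on which side of the midpoint n/2 these
  two consecutive integers lie; in the third, 2 \<Delta> = n + 1 and they are symmetric about it.
\<close>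

lemma position_nth:
  assumes "distinct L" "j < length L"
  shows "position L (L ! j) = j"
  unfolding position_def using assms by (auto simp: nth_eq_iff_index_eq)

text \<open>Once an arrangement is split at a vertex, its position is a prefix length; all four
  positions in the theorem are computed this way.\<close>

lemma position_append_Cons:
  assumes "distinct (A @ w # B)"
  shows "position (A @ w # B) w = length A"
  using position_nth[OF assms, of "length A"] by simp

theorem theorem5:
  fixes n p :: nat
    and O1 O2 P :: "'a list"
    and k u v :: 'a
    and \<Delta> :: int
  assumes "n > 0" and "p > 0"
    and "length P = p"
    and "distinct (O1 @ [k] @ O2 @ P)"
    and "length (O1 @ [k] @ O2 @ P) \<le> n"
    and "u \<in> set P" and "v \<in> set O2"
    and "\<Delta> = int (position (arr_before O1 k O2 P) v) - int (position (arr_before O1 k O2 P) u)"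
  shows "(real_of_int \<Delta> \<le> real n / 2 \<longrightarrow>
            CBS n (arr_after O1 k O2 P) u v = CBS n (arr_before O1 k O2 P) u v - 1)
       \<and> (real_of_int \<Delta> \<ge> real n / 2 + 1 \<longrightarrow>
            CBS n (arr_after O1 k O2 P) u v = CBS n (arr_before O1 k O2 P) u v + 1)
       \<and> (real n / 2 < real_of_int \<Delta> \<and> real_of_int \<Delta> < real n / 2 + 1 \<longrightarrow>
            CBS n (arr_after O1 k O2 P) u v = CBS n (arr_before O1 k O2 P) u v)"
proof -
  let ?B = "arr_before O1 k O2 P" and ?A = "arr_after O1 k O2 P"
  obtain P1 P2 where P: "P = P1 @ u # P2"
    using assms(6) by (meson split_list)
  obtain V1 V2 where O2: "O2 = V1 @ v # V2"
    using assms(7) by (meson split_list)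
  have dB: "distinct ?B" and dA: "distinct ?A"
    using assms(4) by (auto simp: arr_before_def arr_after_def)
  have u_before: "position ?B u = length O1 + length P1"
    using position_append_Cons[of "O1 @ P1" u "P2 @ k # O2"] dB
    by (simp add: arr_before_def P)
  have v_before: "position ?B v = length O1 + length P + 1 + length V1"
    using position_append_Cons[of "O1 @ P @ k # V1" v V2] dB
    by (simp add: arr_before_def O2)
  have u_after: "position ?A u = length O1 + 1 + length P1"
    using position_append_Cons[of "O1 @ k # P1" u "P2 @ O2"] dA
    by (simp add: arr_after_def P)
  have v_after: "position ?A v = length O1 + 1 + length P + length V1"
    using position_append_Cons[of "O1 @ k # P @ V1" v V2] dA
    by (simp add: arr_after_def O2)
  \<comment> \<open>Since \<open>length P1 < length P\<close>, u precedes v. The bound 1 keeps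
    \<Delta> - 1 nonnegative too, so the absolute values disappear both before and after the
    move.\<close>
  have "\<Delta> \<ge> 1"
    using assms(8) arg_cong[OF P, of length] by (simp add: u_before v_before)
  then have before: "CBS n ?B u v = min \<Delta> (int n - \<Delta>)"
    and after: "CBS n ?A u v = min (\<Delta> - 1) (int n - (\<Delta> - 1))"
    using assms(8)
    by (simp_all add: CBS_def cyclic_dist_def u_before v_before u_after v_after)
  \<comment> \<open>Doubling makes the thresholds integral, so the open interval of the third case
    leaves a single value of 2 * \<Delta>.\<close>
  have "real_of_int \<Delta> \<le> real n / 2 \<longleftrightarrow> 2 * \<Delta> \<le> int n"
    "real_of_int \<Delta> \<ge> real n / 2 + 1 \<longleftrightarrow> 2 * \<Delta> \<ge> int n + 2"
    "real n / 2 < real_of_int \<Delta> \<longleftrightarrow> int n < 2 * \<Delta>"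
    "real_of_int \<Delta> < real n / 2 + 1 \<longleftrightarrow> 2 * \<Delta> < int n + 2"
    by linarith+
  \<comment> \<open>Both minima are attained by the first argument in case 1 and by the second in
    case 2. In case 3 the minimum passes from n - \<Delta> to \<Delta> - 1, which are equal
    there.\<close>
  then show ?thesis
    unfolding before after by auto
qed

end
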